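(* Let $m \geq 2$ be an even integer and set $t := \frac{m}{2}$. Define $3t$ polynomials $f_1, \ldots, f_{3t} \in \mathbb{C}[z]$ by \begin{align*} f_i(z) &:= z^{i-1} && (1 \leq i \leq t),\\ f_i(z) &:= (z-1)^{i-1} && (t+1 \leq i \leq 2t),\\ f_i(z) &:= z^{i-t-1}(z-1)^{m-i+t} && (2t+1 \leq i \leq 3t). \end{align*} Then these polynomials are in general position; that is, for any $m$ distinct indices $1 \leq i_1 < i_2 < \cdots < i_m \leq 3t$, the polynomials $f_{i_1}, \ldots, f_{i_m}$ are linearly independent over $\mathbb{C}$. *)

theory Defs
  imports Complex_Main "HOL-Computational_Algebra.Polynomial"
begin

global_interpretation poly_vs: vector_space "smult :: 'a::field \<Rightarrow> 'a poly \<Rightarrow> 'a poly"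
  by unfold_locales (simp_all add: smult_add_right smult_add_left)

(* Independence of a family, as opposed to a set: repeated members are excluded
   by injectivity. *)
definition lin_indep_family :: "('i \<Rightarrow> 'a::field poly) \<Rightarrow> 'i set \<Rightarrow> bool" where
  "lin_indep_family f I \<longleftrightarrow> inj_on f I \<and> poly_vs.independent (f ` I)"

definition in_general_position :: "nat \<Rightarrow> nat \<Rightarrow> (nat \<Rightarrow> 'a::field poly) \<Rightarrow> bool" where
  "in_general_position m n f \<longleftrightarrow>
     (\<forall>I. I \<subseteq> {1..n} \<and> card I = m \<longrightarrow> lin_indep_family f I)"

(* [:0, 1:] is z and [:-1, 1:] is z - 1.  The last exponent is m - i + t, reordered because
   m - i would be truncated in nat (i > m there).  Only the values for i in {1..3 * t} matter. *)
definition gp_poly :: "nat \<Rightarrow> nat \<Rightarrow> complex poly" where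
  "gp_poly m i =
     (let t = m div 2 in
      if i \<le> t then [:0, 1:] ^ (i - 1)
      else if i \<le> 2 * t then [:-1, 1:] ^ (i - 1)
      else [:0, 1:] ^ (i - t - 1) * [:-1, 1:] ^ (m + t - i))"

end

theory Submission
  imports Defs "Jordan_Normal_Form.Determinant" "HOL-Library.Infinite_Set"
begin

text \<open>
  Why the theorem is true. A linear relation among the chosen polynomials can be tested one
  coefficient at a time. The first group consists of monomials of degree below \<open>t\<close>, so it does not
  contribute to the coefficients of \<open>z ^ k\<close> for the exponents \<open>k\<close> that it leaves unused. If \<open>n\<close>
  polynomials are chosen from the other two groups, then exactly \<open>n\<close> exponents below \<open>2 * t\<close> are
  unused, and everything reduces to the nonvanishing of an \<open>n \<times> n\<close> determinant of coefficients.
  All polynomials of the last two groups have the form \<open>z ^ x * (z - 1) ^ (s - x)\<close>, with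
  \<open>x = 0\<close> in the second group and \<open>s = 2 * t - 1\<close> in the third. Up to the factor
  \<open>(-1) ^ (s + k)\<close>, which only rescales rows and columns, the coefficient of \<open>z ^ k\<close> is the binomial
  coefficient \<open>(s - x) choose (k - x)\<close>, so the signs disappear.

  It is therefore enough to show that such a binomial determinant is positive. Listed by increasing
  index, the intervals \<open>[x, s]\<close> move weakly to the right at both ends. Pascal's rule
  \<open>z ^ x * (1 + z) ^ d = z ^ (x + 1) * (1 + z) ^ (d - 1) + z ^ x * (1 + z) ^ (d - 1)\<close>
  shortens an interval at its left or its right end. By linearity in a row, the determinant is the
  sum of the determinants for the two shortened families. In every such chain without repetitions,
  unless all intervals are points, some interval can be shortened at either end without breaking
  the chain, so by induction all the determinants are nonnegative (\<open>pascal_minor_nonneg\<close>). This is the sum over families of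
  non-crossing lattice paths, obtained one step at a time.

  Consequently a determinant only decreases when one of the two summands is dropped, and a positive
  lower bound follows from a single good sequence of shortenings (\<open>pascal_minor_pos\<close>): left ends
  are first raised until they increase strictly (\<open>pascal_minor_raise\<close>), then the right ends are
  lowered to the column exponents (\<open>pascal_minor_lower\<close>), and what remains is unitriangular. For the
  given polynomials, the left end in row \<open>r\<close> of the second group is raised from \<open>0\<close> to \<open>r\<close>;
  counting shows that the required inequalities hold for every choice (\<open>gp_minor_pos\<close>).
\<close>

section \<open>Coefficients of products of powers of z and z - 1\<close>

text \<open>The coefficient of \<open>z ^ k\<close> in \<open>z ^ x * (1 + z) ^ (s - x)\<close>. The interval \<open>[x, s]\<close> is used
  instead of the two exponents because Pascal's rule moves one end of it and fixes the other.\<close>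
definition pascal_coeff :: "nat \<Rightarrow> nat \<Rightarrow> nat \<Rightarrow> nat" where
  "pascal_coeff x s k = (if x \<le> k then (s - x) choose (k - x) else 0)"

lemma pascal_coeff_split:
  assumes "x < s"
  shows "pascal_coeff x s k = pascal_coeff (Suc x) s k + pascal_coeff x (s - 1) k"
proof -
  obtain d where s: "s = Suc (x + d)"
    using assms less_iff_Suc_add by auto
  show ?thesis
  proof (cases "x < k")
    case True
    then obtain e where "k = Suc (x + e)"
      using less_iff_Suc_add by auto
    then show ?thesis by (simp add: pascal_coeff_def s Suc_diff_le)
  next
    case False
    then show ?thesis by (auto simp: pascal_coeff_def)
  qed
qed

lemma pascal_coeff_point: "pascal_coeff x x k = (if k = x then 1 else 0)"
  by (auto simp: pascal_coeff_def)

lemma pascal_coeff_above: "x \<le> s \<Longrightarrow> s < k \<Longrightarrow> pascal_coeff x s k = 0"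
  by (auto simp: pascal_coeff_def intro!: binomial_eq_0)

lemma pascal_coeff_top: "x \<le> s \<Longrightarrow> pascal_coeff x s s = 1"
  by (auto simp: pascal_coeff_def)

lemma coeff_linear_power:
  "coeff ([:-1, 1:] ^ d :: 'a::comm_ring_1 poly) k = (-1) ^ (d + k) * of_nat (d choose k)"
proof (induction d arbitrary: k)
  case 0
  then show ?case by (cases k) auto
next
  case (Suc d)
  show ?case
    by (cases k) (simp_all add: Suc algebra_simps)
qed

text \<open>The sign is a function of \<open>s\<close> times a function of \<open>k\<close>. Since it does not involve \<open>x\<close>, passing
  from \<open>z - 1\<close> to \<open>z + 1\<close> amounts to rescaling rows and columns.\<close>
lemma coeff_pascal_poly:
  assumes "x \<le> s"
  shows "coeff ([:0, 1:] ^ x * [:-1, 1:] ^ (s - x) :: 'a::comm_ring_1 poly) k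
         = (-1) ^ (s + k) * of_nat (pascal_coeff x s k)"
proof -
  have "[:0, 1:] ^ x = (monom 1 x :: 'a poly)"
    by (simp add: monom_altdef)
  moreover have "(-1) ^ (s - x + (k - x)) = ((-1) ^ (s + k) :: 'a)" if "x \<le> k"
    using assms that by (simp add: minus_one_power_iff)
  ultimately show ?thesis
    by (simp add: coeff_monom_mult coeff_linear_power pascal_coeff_def)
qed

section \<open>Determinants of binomial coefficients\<close>

definition pascal_minor :: "nat \<Rightarrow> (nat \<Rightarrow> nat) \<Rightarrow> (nat \<Rightarrow> nat) \<Rightarrow> (nat \<Rightarrow> nat) \<Rightarrow> int" where
  "pascal_minor n x s k =
     det (mat\<^sub>r n n (\<lambda>r. vec n (\<lambda>l. int (pascal_coeff (x r) (s r) (k l)))))"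

lemma pascal_minor_split:
  assumes "r < n" "x r < s r"
  shows "pascal_minor n x s k =
    pascal_minor n (x(r := Suc (x r))) s k + pascal_minor n x (s(r := s r - 1)) k"
proof -
  let ?R = "\<lambda>x s. vec n (\<lambda>l. int (pascal_coeff x s (k l)))"
  let ?c = "\<lambda>i. ?R (x i) (s i)"
  let ?a = "\<lambda>i. ?R (Suc (x i)) (s i)"
  let ?b = "\<lambda>i. ?R (x i) (s i - 1)"
  have "?c r = ?a r + ?b r"
    using pascal_coeff_split[of "x r" "s r"] assms(2) by (intro eq_vecI) auto
  then have "?c = (\<lambda>i. if i = r then ?a i + ?b i else ?c i)"
    by auto
  then have "pascal_minor n x s k = det (mat\<^sub>r n n (\<lambda>i. if i = r then ?a i + ?b i else ?c i))"
    unfolding pascal_minor_def by metis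
  also have "\<dots> = det (mat\<^sub>r n n (\<lambda>i. if i = r then ?a i else ?c i)) +
                   det (mat\<^sub>r n n (\<lambda>i. if i = r then ?b i else ?c i))"
    by (rule det_row_add) (use assms in auto)
  also have "(\<lambda>i. if i = r then ?a i else ?c i) = (\<lambda>i. ?R ((x(r := Suc (x r))) i) (s i))"
    by auto
  also have "(\<lambda>i. if i = r then ?b i else ?c i) = (\<lambda>i. ?R (x i) ((s(r := s r - 1)) i))"
    by auto
  finally show ?thesis unfolding pascal_minor_def .
qed

lemma pascal_minor_cong:
  assumes "\<And>r. r < n \<Longrightarrow> x r = x' r" "\<And>r. r < n \<Longrightarrow> s r = s' r"
  shows "pascal_minor n x s k = pascal_minor n x' s' k"
  unfolding pascal_minor_def
  by (rule arg_cong[where f = det], rule eq_matI) (use assms in auto)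

lemma pascal_minor_zero_row:
  assumes "r < n" "\<And>l. l < n \<Longrightarrow> pascal_coeff (x r) (s r) (k l) = 0"
  shows "pascal_minor n x s k = 0"
proof -
  let ?c = "\<lambda>i. vec n (\<lambda>l. int (pascal_coeff (x i) (s i) (k l)))"
  have "?c r = 0\<^sub>v n" using assms by (intro eq_vecI) auto
  then have "?c = (\<lambda>i. if i = r then 0\<^sub>v n else ?c i)" by auto
  then have "pascal_minor n x s k = det (mat\<^sub>r n n (\<lambda>i. if i = r then 0\<^sub>v n else ?c i))"
    unfolding pascal_minor_def by metis
  also have "\<dots> = 0" by (rule det_row_0) (use assms in auto)
  finally show ?thesis .
qed

lemma pascal_minor_equal_rows:
  assumes "i < j" "j < n" "x i = x j" "s i = s j"
  shows "pascal_minor n x s k = 0"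
  unfolding pascal_minor_def
  by (rule det_identical_rows[of _ n i j]) (use assms in \<open>auto simp: row_mat_of_row_fun\<close>)

lemma pascal_minor_triangular:
  assumes "\<And>r. r < n \<Longrightarrow> x r \<le> k r" and "strict_mono_on {..<n} k"
  shows "pascal_minor n x k k = 1"
proof -
  let ?A = "mat\<^sub>r n n (\<lambda>r. vec n (\<lambda>l. int (pascal_coeff (x r) (k r) (k l))))"
  have "pascal_coeff (x i) (k i) (k j) = 0" if "i < j" "j < n" for i j
    using assms(1)[of i] strict_mono_onD[OF assms(2), of i j] that by (intro pascal_coeff_above) auto
  then have "det ?A = prod_list (diag_mat ?A)"
    by (intro det_lower_triangular[of n]) auto
  also have "\<dots> = 1"
    using assms(1) by (simp add: prod_list_diag_prod pascal_coeff_top)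
  finally show ?thesis unfolding pascal_minor_def .
qed

section \<open>Nonnegativity for chains of intervals\<close>

definition interval_chain :: "nat \<Rightarrow> (nat \<Rightarrow> nat) \<Rightarrow> (nat \<Rightarrow> nat) \<Rightarrow> bool" where
  "interval_chain n x s \<longleftrightarrow>
     (\<forall>r<n. x r \<le> s r) \<and> mono_on {..<n} x \<and> mono_on {..<n} s"

lemma interval_chain_raise:
  assumes chain: "interval_chain n x s" and gap: "x r < s r"
    and right: "\<And>j. r < j \<Longrightarrow> j < n \<Longrightarrow> x r < x j"
  shows "interval_chain n (x(r := Suc (x r))) s"
proof -
  have "mono_on {..<n} (x(r := Suc (x r)))"
  proof (rule mono_onI)
    fix i j assume ij: "i \<in> {..<n}" "j \<in> {..<n}" "i \<le> j"
    then have "x i \<le> x j" using chain by (simp add: interval_chain_def mono_on_def)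
    then show "(x(r := Suc (x r))) i \<le> (x(r := Suc (x r))) j"
      using right[of j] ij by (cases "i = r"; cases "j = r") auto
  qed
  then show ?thesis using chain gap by (auto simp: interval_chain_def)
qed

lemma interval_chain_lower:
  assumes chain: "interval_chain n x s" and gap: "x r < s r"
    and left: "\<And>i. i < r \<Longrightarrow> s i < s r"
  shows "interval_chain n x (s(r := s r - 1))"
proof -
  have "mono_on {..<n} (s(r := s r - 1))"
  proof (rule mono_onI)
    fix i j assume ij: "i \<in> {..<n}" "j \<in> {..<n}" "i \<le> j"
    then have "s i \<le> s j" using chain by (simp add: interval_chain_def mono_on_def)
    then show "(s(r := s r - 1)) i \<le> (s(r := s r - 1)) j"
      using left[of i] ij by (cases "i = r"; cases "j = r") auto
  qed
  then show ?thesis using chain gap by (auto simp: interval_chain_def)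
qed

text \<open>
  Induction on the total length of the intervals. If two rows agree, the determinant is zero. If not,
  a row \<open>r\<close> is needed with a nondegenerate interval, with the left ends of later rows strictly
  larger, and with the right ends of earlier rows strictly smaller; it can be shortened at either
  end, and both summands of Pascal's rule are covered by the induction hypothesis. Take the first
  nondegenerate interval, and for \<open>r\<close> the last row with the same left end: the rows between the two
  share this left end, so their right ends increase strictly, while the earlier intervals are
  points. If all intervals are points, the rows are zero or unit vectors in increasing order.
\<close>
lemma pascal_minor_nonneg:
  assumes "interval_chain n x s" and k: "strict_mono_on {..<n} k"
  shows "pascal_minor n x s k \<ge> 0"
  using assms(1)
proof (induction "\<Sum>r<n. s r - x r" arbitrary: x s rule: less_induct)
  case less
  note chain = less.prems
  have le: "x r \<le> s r" if "r < n" for r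
    using chain that by (auto simp: interval_chain_def)
  have mono: "x i \<le> x j" "s i \<le> s j" if "i < j" "j < n" for i j
    using chain that by (auto simp: interval_chain_def mono_on_def)
  consider (eq) i j where "i < j" "j < n" "x i = x j" "s i = s j"
    | (strict) "\<And>i j. i < j \<Longrightarrow> j < n \<Longrightarrow> x i = x j \<Longrightarrow> s i \<noteq> s j"
    by blast
  then show ?case
  proof cases
    case eq
    then show ?thesis by (simp add: pascal_minor_equal_rows)
  next
    case strict
    show ?thesis
    proof (cases "\<exists>r<n. x r < s r")
      case True
      define r0 where "r0 = (LEAST r. r < n \<and> x r < s r)"
      have r0: "r0 < n" "x r0 < s r0"
        using LeastI_ex[OF True] unfolding r0_def by auto
      have before: "x i = s i" if "i < r0" for i
        using not_less_Least[of i "\<lambda>r. r < n \<and> x r < s r"] that le[of i] r0(1)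
        unfolding r0_def by force
      define r where "r = Max {q. q < n \<and> x q = x r0}"
      have fin: "finite {q. q < n \<and> x q = x r0}" by simp
      have "r \<in> {q. q < n \<and> x q = x r0}"
        unfolding r_def by (rule Max_in) (use r0 in auto)
      then have r: "r < n" "x r = x r0" by auto
      have "r0 \<le> r" unfolding r_def by (rule Max_ge) (use r0 in auto)
      then have "s r0 \<le> s r" using mono(2)[of r0 r] r by (cases "r0 = r") auto
      then have gap: "x r < s r" using r r0 by simp
      have right: "x r < x j" if "r < j" "j < n" for j
      proof -
        have "x j \<noteq> x r0" using Max_ge[OF fin, of j] that
          unfolding r_def by (auto simp: not_le[symmetric])
        then show ?thesis using mono(1)[OF that] r by simp
      qed
      have left: "s i < s r" if "i < r" for i
      proof (cases "i < r0")
        case True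
        then show ?thesis using before[of i] mono(1)[of i r0] r0 \<open>s r0 \<le> s r\<close> by simp
      next
        case False
        then have "x r0 \<le> x i" using mono(1)[of r0 i] that r by (cases "i = r0") auto
        then have "x i = x r" using mono(1)[OF that] r by simp
        then show ?thesis using strict[OF that] mono(2)[OF that] r by simp
      qed
      have "0 \<le> pascal_minor n (x(r := Suc (x r))) s k"
        by (rule less.hyps[OF _ interval_chain_raise[OF chain gap right]],
            rule sum_strict_mono_ex1) (use r gap in \<open>auto intro!: bexI[of _ r]\<close>)
      moreover have "0 \<le> pascal_minor n x (s(r := s r - 1)) k"
        by (rule less.hyps[OF _ interval_chain_lower[OF chain gap left]],
            rule sum_strict_mono_ex1) (use r gap in \<open>auto intro!: bexI[of _ r]\<close>)
      ultimately show ?thesis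
        using pascal_minor_split[of r n x s k] r gap by simp
    next
      case False
      then have xs: "s r = x r" if "r < n" for r using le that by force
      have x: "strict_mono_on {..<n} x"
      proof (rule strict_mono_onI)
        fix i j assume "i \<in> {..<n}" "j \<in> {..<n}" "i < j"
        then show "x i < x j" using strict[of i j] mono[of i j] xs by force
      qed
      show ?thesis
      proof (cases "x ` {..<n} \<subseteq> k ` {..<n}")
        case True
        \<comment> \<open>Two increasing sequences with the same range agree, which makes the matrix the identity.\<close>
        then have "x ` {..<n} = k ` {..<n}"
          by (intro card_subset_eq)
             (auto simp: card_image[OF strict_mono_on_imp_inj_on[OF x]]
                card_image[OF strict_mono_on_imp_inj_on[OF k]])
        moreover have sorted_map: "sorted (map f [0..<n])"
          if "strict_mono_on {..<n} f" for f :: "nat \<Rightarrow> nat"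
          using mono_onD[OF strict_mono_on_imp_mono_on[OF that]]
          by (simp add: sorted_iff_nth_mono_less)
        ultimately have "map x [0..<n] = map k [0..<n]"
          using sorted_map[OF x] sorted_map[OF k]
            strict_mono_on_imp_inj_on[OF x] strict_mono_on_imp_inj_on[OF k]
          by (intro sorted_distinct_set_unique)
             (auto simp: distinct_map atLeast0LessThan)
        then have "x r = k r" if "r < n" for r using that by simp
        then have "pascal_minor n x s k = pascal_minor n k k k"
          using xs by (intro pascal_minor_cong) auto
        then show ?thesis using pascal_minor_triangular[of n k k] k by simp
      next
        case False
        then obtain r where "r < n" "x r \<notin> k ` {..<n}" by auto
        then have "pascal_minor n x s k = 0"
          by (intro pascal_minor_zero_row[of r]) (auto simp: xs pascal_coeff_point, metis imageI lessThan_iff)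
        then show ?thesis by simp
      qed
    qed
  qed
qed

section \<open>Positivity for chains of intervals\<close>

text \<open>
  Each raise of a left end keeps one of the two summands of Pascal's rule and drops the other,
  which is nonnegative. The last row that still has to be raised goes first: the later left ends
  are already strictly increasing, so there is room to its right. The hypothesis on \<open>s\<close> makes the
  dropped summand a chain as well.
\<close>
lemma pascal_minor_raise:
  assumes "interval_chain n x s" and k: "strict_mono_on {..<n} k"
    and y: "\<And>r. r < n \<Longrightarrow> x r \<le> y r \<and> y r \<le> s r" "strict_mono_on {..<n} y"
    and s: "\<And>i j. i < j \<Longrightarrow> j < n \<Longrightarrow> x j < y j \<Longrightarrow> s i < s j"
  shows "pascal_minor n y s k \<le> pascal_minor n x s k"
  using assms(1) y(1) s
proof (induction "\<Sum>r<n. y r - x r" arbitrary: x rule: less_induct)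
  case less
  note chain = less.prems(1) and xy = less.prems(2) and s = less.prems(3)
  show ?case
  proof (cases "\<exists>r<n. x r < y r")
    case True
    define r where "r = Max {r. r < n \<and> x r < y r}"
    have fin: "finite {r. r < n \<and> x r < y r}" by simp
    have "r \<in> {r. r < n \<and> x r < y r}"
      unfolding r_def by (rule Max_in) (use True in auto)
    then have r: "r < n" "x r < y r" by auto
    then have gap: "x r < s r" using xy[of r] by simp
    have right: "x r < x j" if "r < j" "j < n" for j
    proof -
      have "\<not> x j < y j" using Max_ge[OF fin, of j] that
        unfolding r_def by (auto simp: not_le[symmetric])
      then show ?thesis using xy[of j] strict_mono_onD[OF y(2), of r j] r that by simp
    qed
    have left: "s i < s r" if "i < r" for i using s that r by simp
    note up = interval_chain_raise[OF chain gap right]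
    note down = interval_chain_lower[OF chain gap left]
    have "pascal_minor n y s k \<le> pascal_minor n (x(r := Suc (x r))) s k"
    proof (rule less.hyps[OF _ up])
      show "(\<Sum>q<n. y q - (x(r := Suc (x r))) q) < (\<Sum>q<n. y q - x q)"
        by (rule sum_strict_mono_ex1) (use r in \<open>auto intro!: bexI[of _ r]\<close>)
    qed (use xy s r in \<open>auto split: if_splits\<close>)
    then show ?thesis
      using pascal_minor_split[of r n x s k] r gap pascal_minor_nonneg[OF down k] by simp
  next
    case False
    then have "y r = x r" if "r < n" for r using xy[of r] that by force
    then have "pascal_minor n x s k = pascal_minor n y s k"
      by (intro pascal_minor_cong) auto
    then show ?thesis by simp
  qed
qed

text \<open>The mirror image of \<open>pascal_minor_raise\<close>: here the first row that still has to be lowered goes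
  first, because the right ends before it have reached their strictly increasing targets.\<close>
lemma pascal_minor_lower:
  assumes "interval_chain n x s" and k: "strict_mono_on {..<n} k"
    and x: "strict_mono_on {..<n} x"
    and u: "\<And>r. r < n \<Longrightarrow> x r \<le> u r \<and> u r \<le> s r" "strict_mono_on {..<n} u"
  shows "pascal_minor n x u k \<le> pascal_minor n x s k"
  using assms(1) u(1)
proof (induction "\<Sum>r<n. s r - u r" arbitrary: s rule: less_induct)
  case less
  note chain = less.prems(1) and us = less.prems(2)
  show ?case
  proof (cases "\<exists>r<n. u r < s r")
    case True
    define r where "r = (LEAST r. r < n \<and> u r < s r)"
    have r: "r < n" "u r < s r"
      using LeastI_ex[OF True] unfolding r_def by auto
    have gap: "x r < s r" using us[of r] r by simp
    have left: "s i < s r" if "i < r" for i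
    proof -
      have "\<not> u i < s i"
        using not_less_Least[of i "\<lambda>r. r < n \<and> u r < s r"] that r(1) unfolding r_def by auto
      then show ?thesis using us[of i] strict_mono_onD[OF u(2), of i r] r that by simp
    qed
    have right: "x r < x j" if "r < j" "j < n" for j
      using strict_mono_onD[OF x, of r j] that by simp
    note up = interval_chain_raise[OF chain gap right]
    note down = interval_chain_lower[OF chain gap left]
    have "pascal_minor n x u k \<le> pascal_minor n x (s(r := s r - 1)) k"
    proof (rule less.hyps[OF _ down])
      show "(\<Sum>q<n. (s(r := s r - 1)) q - u q) < (\<Sum>q<n. s q - u q)"
        by (rule sum_strict_mono_ex1) (use r in \<open>auto intro!: bexI[of _ r]\<close>)
    qed (use us r in auto)
    then show ?thesis
      using pascal_minor_split[of r n x s k] r gap pascal_minor_nonneg[OF up k] by simp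
  next
    case False
    then have "u r = s r" if "r < n" for r using us[of r] that by force
    then have "pascal_minor n x s k = pascal_minor n x u k"
      by (intro pascal_minor_cong) auto
    then show ?thesis by simp
  qed
qed

text \<open>The sequence \<open>y\<close> is a strictly increasing intermediate position for the left ends. The bounds
  \<open>x r \<le> k r \<le> s r\<close> alone do not give positivity, even for distinct intervals: the relation
  \<open>(1 + z) ^ 2 = (1 + z) + z * (1 + z)\<close> makes the determinant zero for \<open>[0, 1]\<close>, \<open>[0, 2]\<close>, \<open>[1, 2]\<close> and
  the exponents \<open>0, 1, 2\<close>.\<close>
lemma pascal_minor_pos:
  assumes chain: "interval_chain n x s" and k: "strict_mono_on {..<n} k"
    and y: "strict_mono_on {..<n} y"
    and xyks: "\<And>r. r < n \<Longrightarrow> x r \<le> y r \<and> y r \<le> k r \<and> k r \<le> s r"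
    and s: "\<And>i j. i < j \<Longrightarrow> j < n \<Longrightarrow> x j < y j \<Longrightarrow> s i < s j"
  shows "pascal_minor n x s k > 0"
proof -
  have y_chain: "interval_chain n y s"
    using chain xyks strict_mono_on_imp_mono_on[OF y]
    unfolding interval_chain_def by (meson le_trans)
  have "1 = pascal_minor n y k k"
    using pascal_minor_triangular[of n y k] xyks k by simp
  also have "\<dots> \<le> pascal_minor n y s k"
    by (rule pascal_minor_lower[OF y_chain k y _ k]) (simp add: xyks)
  also have "\<dots> \<le> pascal_minor n x s k"
  proof (rule pascal_minor_raise[OF chain k _ y s])
    show "x r \<le> y r \<and> y r \<le> s r" if "r < n" for r
      using xyks[OF that] by simp
  qed
  finally show ?thesis by simp
qed

section \<open>From determinants to linear independence\<close>

text \<open>The integer determinant is transported to the coefficient field here, so that the order on the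
  integers could be used for positivity while the relation may have complex coefficients.\<close>
lemma pascal_minor_nonzero_kernel:
  fixes v :: "nat \<Rightarrow> 'a::field_char_0"
  assumes "pascal_minor n x s k \<noteq> 0"
    and v: "\<And>l. l < n \<Longrightarrow> (\<Sum>r<n. v r * of_nat (pascal_coeff (x r) (s r) (k l))) = 0"
    and "r < n"
  shows "v r = 0"
proof -
  let ?M = "mat\<^sub>r n n (\<lambda>r. vec n (\<lambda>l. int (pascal_coeff (x r) (s r) (k l))))"
  let ?A = "transpose_mat (map_mat of_int ?M) :: 'a mat"
  have A: "?A \<in> carrier_mat n n" by simp
  have "det ?A = det (map_mat of_int ?M :: 'a mat)"
    by (rule det_transpose[of _ n]) simp
  also have "\<dots> = of_int (det ?M)"
    by (rule of_int_hom.hom_det)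
  finally have "det ?A = of_int (det ?M)" .
  then have "det ?A \<noteq> 0" using assms(1) by (simp add: pascal_minor_def)
  moreover have "?A *\<^sub>v vec n v = 0\<^sub>v n"
  proof (rule eq_vecI)
    fix l assume "l < dim_vec (0\<^sub>v n :: 'a vec)"
    then have l: "l < n" by simp
    then have "(?A *\<^sub>v vec n v) $ l =
        (\<Sum>r<n. v r * of_nat (pascal_coeff (x r) (s r) (k l)))"
      by (simp add: scalar_prod_def atLeast0LessThan mult.commute)
    then show "(?A *\<^sub>v vec n v) $ l = 0\<^sub>v n $ l" using v[OF l] l by simp
  qed simp
  ultimately have "vec n v = 0\<^sub>v n"
    using det_0_iff_vec_prod_zero_field[OF A] vec_carrier[of n v] by blast
  then have "vec n v $ r = 0\<^sub>v n $ r" by (rule arg_cong)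
  then show ?thesis using \<open>r < n\<close> by simp
qed

text \<open>Relations indexed by \<open>I\<close> also detect repeated members: if \<open>f i = f j\<close>, then the coefficients
  \<open>1\<close> at \<open>i\<close> and \<open>-1\<close> at \<open>j\<close> form a nontrivial relation.\<close>
lemma lin_indep_familyI:
  fixes f :: "'i \<Rightarrow> 'a::field poly"
  assumes fin: "finite I"
    and zero: "\<And>c i. (\<Sum>i\<in>I. Polynomial.smult (c i) (f i)) = 0 \<Longrightarrow> i \<in> I \<Longrightarrow> c i = 0"
  shows "lin_indep_family f I"
proof -
  have inj: "inj_on f I"
  proof (rule inj_onI, rule ccontr)
    fix i j assume ij: "i \<in> I" "j \<in> I" "f i = f j" "i \<noteq> j"
    let ?c = "\<lambda>l. if l = i then 1 else if l = j then -1 else (0 :: 'a)"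
    have "(\<Sum>l\<in>I. Polynomial.smult (?c l) (f l)) = (\<Sum>l\<in>{i, j}. Polynomial.smult (?c l) (f l))"
      by (rule sum.mono_neutral_right) (use fin ij in auto)
    also have "\<dots> = 0" using ij by simp
    finally show False using zero[of ?c i] ij by simp
  qed
  have "poly_vs.independent (f ` I)"
  proof
    assume "poly_vs.dependent (f ` I)"
    then obtain u i where u: "i \<in> I" "u (f i) \<noteq> 0" "(\<Sum>v\<in>f ` I. Polynomial.smult (u v) v) = 0"
      using poly_vs.dependent_finite[of "f ` I"] fin by auto
    then show False using zero[of "\<lambda>i. u (f i)" i] by (simp add: sum.reindex[OF inj])
  qed
  then show ?thesis using inj by (simp add: lin_indep_family_def)
qed

section \<open>Position bounds for increasing sequences\<close>

lemma strict_seq_bounds: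
  fixes f :: "nat \<Rightarrow> nat"
  assumes strict: "strict_mono_on {..<n} f"
    and range: "\<And>r. r < n \<Longrightarrow> a \<le> f r \<and> f r < b"
    and "r < n"
  shows "a + r \<le> f r" and "f r + n \<le> b + r"
proof -
  show "a + r \<le> f r"
    using \<open>r < n\<close>
  proof (induction r)
    case 0
    then show ?case using range by simp
  next
    case (Suc r)
    then show ?case using strict_mono_onD[OF strict, of r "Suc r"] by simp
  qed
  \<comment> \<open>The upper bound is the lower bound read from the end of the sequence.\<close>
  have "f (n - Suc q) + Suc q \<le> b" if "q < n" for q
    using that
  proof (induction q)
    case 0
    then show ?case using range[of "n - 1"] by simp
  next
    case (Suc q)
    then have "f (n - Suc (Suc q)) < f (n - Suc q)" by (intro strict_mono_onD[OF strict]) auto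
    then show ?case using Suc by simp
  qed
  from this[of "n - Suc r"] \<open>r < n\<close> show "f r + n \<le> b + r" by simp
qed

text \<open>If \<open>f r\<close> were smaller, the \<open>n - r\<close> top values would have to be taken at the \<open>n - r - 1\<close>
  positions after \<open>r\<close>.\<close>
lemma strict_seq_contains_top:
  fixes f :: "nat \<Rightarrow> nat"
  assumes strict: "strict_mono_on {..<n} f"
    and top: "{b - (n - r)..<b} \<subseteq> f ` {..<n}"
    and "r < n" "n - r \<le> b"
  shows "b - (n - r) \<le> f r"
proof (rule ccontr)
  assume "\<not> b - (n - r) \<le> f r"
  then have low: "f r < b - (n - r)" by simp
  have "{b - (n - r)..<b} \<subseteq> f ` {Suc r..<n}"
  proof
    fix v assume v: "v \<in> {b - (n - r)..<b}"
    then obtain q where q: "q < n" "v = f q" using top by blast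
    have "r < q"
    proof (rule ccontr)
      assume "\<not> r < q"
      then have "f q \<le> f r" using strict_mono_onD[OF strict, of q r] \<open>r < n\<close> by (cases "q = r") auto
      then show False using low v q by simp
    qed
    then show "v \<in> f ` {Suc r..<n}" using q by auto
  qed
  then have "card {b - (n - r)..<b} \<le> card (f ` {Suc r..<n})"
    by (intro card_mono) auto
  also have "\<dots> \<le> card {Suc r..<n}"
    by (rule card_image_le) simp
  finally show False using assms(3,4) by simp
qed


section \<open>The polynomials in general position\<close>

text \<open>For \<open>t < i \<le> 3 * t\<close>, the polynomial with index \<open>i\<close> is
  \<open>z ^ gp_low t i * (z - 1) ^ (gp_high t i - gp_low t i)\<close>. Both ends are weakly increasing in \<open>i\<close>
  across the two groups, which is what makes the rows a chain.\<close>
definition gp_low :: "nat \<Rightarrow> nat \<Rightarrow> nat" where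
  "gp_low t i = (if i \<le> 2 * t then 0 else i - t - 1)"

definition gp_high :: "nat \<Rightarrow> nat \<Rightarrow> nat" where
  "gp_high t i = min (i - 1) (2 * t - 1)"

lemma gp_low_le_high: "t < i \<Longrightarrow> i \<le> 3 * t \<Longrightarrow> gp_low t i \<le> gp_high t i"
  by (auto simp: gp_low_def gp_high_def)

lemma coeff_gp_poly_monomial:
  assumes "1 \<le> i" "i \<le> t"
  shows "coeff (gp_poly (2 * t) i) k = (if k = i - 1 then 1 else 0)"
  using assms by (simp add: gp_poly_def flip: monom_altdef[of 1, simplified])

lemma coeff_gp_poly:
  assumes "t < i" "i \<le> 3 * t"
  shows "coeff (gp_poly (2 * t) i) k =
    (-1) ^ (gp_high t i + k) * of_nat (pascal_coeff (gp_low t i) (gp_high t i) k)"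
proof -
  have "gp_poly (2 * t) i = [:0, 1:] ^ gp_low t i * [:-1, 1:] ^ (gp_high t i - gp_low t i)"
  proof (cases "i \<le> 2 * t")
    case True
    then show ?thesis
      using assms by (simp add: gp_poly_def gp_low_def gp_high_def min_def)
  next
    case False
    then have "2 * t + t - i = 2 * t - 1 - (i - t - 1)" using assms by simp
    then show ?thesis
      using False assms by (simp add: gp_poly_def gp_low_def gp_high_def min_def)
  qed
  then show ?thesis using coeff_pascal_poly[OF gp_low_le_high[OF assms]] by simp
qed

text \<open>
  Here \<open>e\<close> lists the chosen indices above \<open>t\<close> and \<open>k\<close> the unused exponents, which include
  \<open>t, \<dots>, 2 * t - 1\<close>. In the second group the right ends \<open>e r - 1\<close> are distinct, so the left ends can
  be raised from \<open>0\<close> to \<open>r\<close>. Since \<open>e r \<ge> t + 1 + r\<close>, the left ends \<open>e r - t - 1\<close> of the third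
  group are at least \<open>r\<close> already. Hence \<open>max r (gp_low t (e r))\<close> describes both cases. The third group
  supplies at most \<open>t\<close> rows, all at the end, and there \<open>k r = 2 * t - (n - r)\<close>, which is
  at least \<open>e r - t - 1\<close>.
\<close>
lemma gp_minor_pos:
  assumes e: "strict_mono_on {..<n} e" "e ` {..<n} \<subseteq> {t<..3 * t}"
    and k: "strict_mono_on {..<n} k" "k ` {..<n} \<subseteq> {..<2 * t}" "{t..<2 * t} \<subseteq> k ` {..<n}"
  shows "pascal_minor n (\<lambda>r. gp_low t (e r)) (\<lambda>r. gp_high t (e r)) k > 0"
proof -
  let ?x = "\<lambda>r. gp_low t (e r)" and ?s = "\<lambda>r. gp_high t (e r)"
  let ?y = "\<lambda>r. max r (?x r)"
  have er: "t < e r" "e r \<le> 3 * t" if "r < n" for r using e(2) that by auto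
  have e_less: "e i < e j" if "i < j" "j < n" for i j
    using strict_mono_onD[OF e(1)] that by simp
  have e_low: "t + 1 + r \<le> e r" if "r < n" for r
    by (rule strict_seq_bounds(1)[OF e(1), where b = "3 * t + 1"])
       (use er that in \<open>auto simp: Suc_le_eq less_Suc_eq_le\<close>)
  have e_up: "e r + n \<le> 3 * t + 1 + r" if "r < n" for r
    by (rule strict_seq_bounds(2)[OF e(1), where a = "t + 1"])
       (use er that in \<open>auto simp: Suc_le_eq less_Suc_eq_le\<close>)
  have k_low: "r \<le> k r" if "r < n" for r
    using strict_seq_bounds(1)[OF k(1), of 0 "2 * t" r] k(2) that by auto
  have k_up: "k r + n \<le> 2 * t + r" if "r < n" for r
    by (rule strict_seq_bounds(2)[OF k(1), where a = 0]) (use k(2) that in auto)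
  have "card {t..<2 * t} \<le> card (k ` {..<n})" by (rule card_mono) (use k in auto)
  then have tn: "t \<le> n" using card_image_le[of "{..<n}" k] by simp
  have k_top: "2 * t - (n - r) \<le> k r" if "r < n" "n - r \<le> t" for r
    by (rule strict_seq_contains_top[OF k(1)]) (use that in \<open>auto intro!: subset_trans[OF _ k(3)]\<close>)
  show ?thesis
  proof (rule pascal_minor_pos[where y = ?y])
    show "interval_chain n ?x ?s"
      unfolding interval_chain_def
    proof (intro conjI allI impI mono_onI)
      fix r assume "r < n"
      then show "?x r \<le> ?s r" using gp_low_le_high er by simp
    next
      fix i j assume "i \<in> {..<n}" "j \<in> {..<n}" "i \<le> j"
      then have "e i \<le> e j" using e_less[of i j] by (cases "i = j") auto
      then show "?x i \<le> ?x j" "?s i \<le> ?s j" by (auto simp: gp_low_def gp_high_def)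
    qed
    show "strict_mono_on {..<n} k" by fact
    show "strict_mono_on {..<n} ?y"
    proof (rule strict_mono_onI)
      fix i j assume "i \<in> {..<n}" "j \<in> {..<n}" "i < j"
      then show "?y i < ?y j"
        using e_less[of i j] e_low[of i] er[of i] by (auto simp: gp_low_def)
    qed
    show "?x r \<le> ?y r \<and> ?y r \<le> k r \<and> k r \<le> ?s r" if "r < n" for r
    proof (cases "e r \<le> 2 * t")
      case True
      then show ?thesis
        using k_low[OF that] k_up[OF that] e_low[OF that] tn that
        by (auto simp: gp_low_def gp_high_def)
    next
      case False
      then have "?x r \<le> 2 * t - (n - r)" "n - r \<le> t"
        using e_up[OF that] that by (auto simp: gp_low_def)
      then show ?thesis
        using k_low[OF that] k_up[OF that] k_top[OF that] that False
        by (auto simp: gp_high_def)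
    qed
    show "?s i < ?s j" if "i < j" "j < n" "?x j < ?y j" for i j
      using that e_less[of i j] e_low[of j] er[of i]
      by (auto simp: gp_low_def gp_high_def split: if_splits)
  qed
qed

theorem theorem1p5:
  fixes m t :: nat
  assumes "m \<ge> 2" and "even m" and "t = m div 2"
  shows "in_general_position m (3 * t) (gp_poly m)"
proof -
  have m: "m = 2 * t" using assms by simp
  have "lin_indep_family (gp_poly m) I" if I: "I \<subseteq> {1..3 * t}" "card I = m" for I
  proof (rule lin_indep_familyI)
    show fin: "finite I" using I(1) finite_subset by blast
    fix c i assume sum0: "(\<Sum>i\<in>I. Polynomial.smult (c i) (gp_poly m i)) = 0" and "i \<in> I"
    define A where "A = {i \<in> I. i \<le> t}"
    define J where "J = {i \<in> I. t < i}"
    define K where "K = {..<2 * t} - (\<lambda>i. i - 1) ` A"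
    have finAJ: "finite A" "finite J" and IAJ: "I = A \<union> J" "A \<inter> J = {}"
      using fin by (auto simp: A_def J_def)
    have A: "1 \<le> i" "i \<le> t" if "i \<in> A" for i using that I(1) by (auto simp: A_def)
    have coeff0: "(\<Sum>i\<in>I. c i * coeff (gp_poly m i) l) = 0" for l
      using arg_cong[OF sum0, of "\<lambda>p. coeff p l"] by (simp add: coeff_sum)
    have "card ((\<lambda>i. i - 1) ` A) = card A"
    proof (rule card_image, rule inj_onI)
      fix i j assume "i \<in> A" "j \<in> A" "i - 1 = j - 1"
      then show "i = j" using A[of i] A[of j] by linarith
    qed
    moreover have "(\<lambda>i. i - 1) ` A \<subseteq> {..<2 * t}" using A by fastforce
    ultimately have "card K = 2 * t - card A"
      using finAJ by (simp add: K_def card_Diff_subset)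
    moreover have "2 * t = card A + card J"
      using I(2) m card_Un_disjoint[OF finAJ IAJ(2)] IAJ(1) by simp
    ultimately have "card K = card J" by simp
    then obtain e k where e: "bij_betw e {..<card J} J" "strict_mono_on {..<card J} e"
      and k: "bij_betw k {..<card J} K" "strict_mono_on {..<card J} k"
      using ex_bij_betw_strict_mono_card[of J] ex_bij_betw_strict_mono_card[of K] finAJ
      by (metis K_def finite_Diff finite_lessThan)
    have eJ: "e ` {..<card J} = J" and kK: "k ` {..<card J} = K"
      using e k by (simp_all add: bij_betw_def)
    have J_range: "J \<subseteq> {t<..3 * t}" using I(1) by (auto simp: J_def)
    have "{t..<2 * t} \<subseteq> K" using A unfolding K_def by fastforce
    then have minor: "pascal_minor (card J) (\<lambda>r. gp_low t (e r)) (\<lambda>r. gp_high t (e r)) k > 0"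
      by (intro gp_minor_pos e k) (use J_range in \<open>auto simp: eJ kK K_def\<close>)
    \<comment> \<open>At the exponents in \<open>K\<close> only the indices in \<open>J\<close> contribute, so the minor kills their coefficients.\<close>
    have J0: "c j = 0" if "j \<in> J" for j
    proof -
      have "j \<in> e ` {..<card J}" using that by (simp add: eJ)
      then obtain r where r: "r < card J" "j = e r" by auto
      \<comment> \<open>The row signs are absorbed into the unknowns; the column signs cancel from each equation.\<close>
      define v where "v = (\<lambda>r. c (e r) * (-1) ^ gp_high t (e r))"
      have "v r = 0"
      proof (rule pascal_minor_nonzero_kernel)
        show "pascal_minor (card J) (\<lambda>r. gp_low t (e r)) (\<lambda>r. gp_high t (e r)) k \<noteq> 0"
          using minor by simp
        fix l assume "l < card J"
        then have "k l \<in> K" using kK by auto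
        then have "coeff (gp_poly m i) (k l) = 0" if "i \<in> A" for i
          using coeff_gp_poly_monomial[OF A[OF that]] that by (auto simp: m K_def)
        then have "(\<Sum>i\<in>J. c i * coeff (gp_poly m i) (k l)) = 0"
          using coeff0[of "k l"] by (simp add: IAJ(1) sum.union_disjoint[OF finAJ IAJ(2)])
        then have "0 = (\<Sum>r<card J. c (e r) * coeff (gp_poly m (e r)) (k l))"
          using sum.reindex_bij_betw[OF e(1), of "\<lambda>i. c i * coeff (gp_poly m i) (k l)"] by simp
        also have "\<dots> = (\<Sum>r<card J. (-1) ^ k l *
            (v r * of_nat (pascal_coeff (gp_low t (e r)) (gp_high t (e r)) (k l))))"
        proof (rule sum.cong)
          fix r assume "r \<in> {..<card J}"
          then have "e r \<in> J" by (rule bij_betw_apply[OF e(1)])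
          then have "t < e r" "e r \<le> 3 * t" using J_range by auto
          then show "c (e r) * coeff (gp_poly m (e r)) (k l) = (-1) ^ k l *
            (v r * of_nat (pascal_coeff (gp_low t (e r)) (gp_high t (e r)) (k l)))"
            by (simp add: m coeff_gp_poly v_def power_add)
        qed simp
        finally show "(\<Sum>r<card J. v r * of_nat (pascal_coeff (gp_low t (e r)) (gp_high t (e r)) (k l))) = 0"
          by (simp flip: sum_distrib_left)
      qed (fact r(1))
      then show ?thesis by (simp add: v_def r(2))
    qed
    show "c i = 0"
    proof (cases "i \<in> J")
      case False
      then have i: "i \<in> A" using \<open>i \<in> I\<close> IAJ by auto
      have "(\<Sum>j\<in>I. c j * coeff (gp_poly m j) (i - 1)) = (\<Sum>j\<in>{i}. c j * coeff (gp_poly m j) (i - 1))"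
      proof (rule sum.mono_neutral_right)
        show "\<forall>j\<in>I - {i}. c j * coeff (gp_poly m j) (i - 1) = 0"
        proof
          fix j assume j: "j \<in> I - {i}"
          show "c j * coeff (gp_poly m j) (i - 1) = 0"
          proof (cases "j \<in> J")
            case False
            then have "j \<in> A" using j IAJ by auto
            then show ?thesis
              using coeff_gp_poly_monomial[OF A, of j] A[of j] A[OF i] j by (auto simp: m)
          qed (simp add: J0)
        qed
      qed (use fin \<open>i \<in> I\<close> in auto)
      then show ?thesis
        using coeff0[of "i - 1"] coeff_gp_poly_monomial[OF A[OF i]] by (simp add: m)
    qed (simp add: J0)
  qed
  then show ?thesis by (simp add: in_general_position_def)
qed

end
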